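(* Let $p(y)$ be the uniform distribution on $\{0,1\}$. Let $p_\theta(x|y)$ be the family of conditional distributions with $p_\theta(x|y=0)=p_{g_\theta}(x)$ (the generator distribution, depending on the parameter $\theta$) and $p_\theta(x|y=1)=p_{data}(x)$ (a fixed distribution not depending on $\theta$). Let $(\theta_0,\phi_0)$ be the parameter values from the last iteration, let $q_{\phi_0}(y|x)$ be the discriminator's conditional distribution of $y\in\{0,1\}$ given $x$, and let $q^{r}_{\phi_0}(y|x)=q_{\phi_0}(1-y|x)$. Put $p_{\theta_0}(x)=\mathbb{E}_{p(y)}[p_{\theta_0}(x|y)]$ and, for each $y\in\{0,1\}$, let $q^{r}(x|y)$ be the distribution over $x$ with $q^{r}(x|y)\propto q^{r}_{\phi_0}(y|x)\,p_{\theta_0}(x)$. Then the update of $\theta$ at $\theta_0$ satisfies $$\nabla_{\theta}\Big[-\mathbb{E}_{p_\theta(x|y)p(y)}\big[\log q^{r}_{\phi_0}(y|x)\big]\Big]\Big|_{\theta=\theta_0} =\nabla_{\theta}\Big[\mathbb{E}_{p(y)}\big[\mathrm{KL}\big(p_\theta(x|y)\,\|\,q^{r}(x|y)\big)\big]-\mathrm{JSD}\big(p_\theta(x|y=0)\,\|\,p_\theta(x|y=1)\big)\Big]\Big|_{\theta=\theta_0},$$ where $\mathrm{KL}(\cdot\|\cdot)$ and $\mathrm{JSD}(\cdot\|\cdot)$ are the Kullback-Leibler and Jensen-Shannon divergences, respectively.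
   Context: Setting (generative adversarial networks). $x$ denotes a real example or a generated sample, and $y\in\{0,1\}$ is an indicator ($y=1$: real, $y=0$: generated). $p_{g_\theta}$ is the distribution of $G_\theta(z)$, where $z$ is drawn from a prior and $G_\theta$ is a generator with parameter $\theta$; $p_{data}$ is the real data distribution. The discriminator $D_\phi$, with parameter $\phi$, gives a conditional distribution $q_\phi(y|x)$ on $\{0,1\}$ with $q_\phi(y=1|x)=D_\phi(x)$; no optimality of the discriminator is assumed. The objects $q^{r}_{\phi_0}(y|x)$, $p_{\theta_0}(x)$ and $q^{r}(x|y)$ depend on $\theta_0,\phi_0$ but not on the variable $\theta$, so they are held fixed when differentiating. The expectation $\mathbb{E}_{p_\theta(x|y)p(y)}$ means $y\sim p(y)$ and then $x\sim p_\theta(x|y)$. $\mathrm{KL}(p\|q)=\mathbb{E}_{p}[\log(p/q)]$, and $\mathrm{JSD}(p\|q)=\frac12\mathrm{KL}(p\|m)+\frac12\mathrm{KL}(q\|m)$ with $m=\frac12(p+q)$. *)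

theory Defs
  imports "HOL-Probability.Probability"
begin

(* KL_divergence b M N is the divergence of N from M (reference measure first), so the
   arguments are swapped here: KL P Q is the expectation under P of ln (dP/dQ). *)
definition KL :: "'x measure \<Rightarrow> 'x measure \<Rightarrow> real" where
  "KL P Q = KL_divergence (exp 1) Q P"

(* For probability measures with P absolutely continuous w.r.t. Q, the negative part of
   ln (dP/dQ) is always P-integrable; hence this says exactly that the divergence in
   [0, \<infinity>] is not \<infinity>, i.e. that the real number KL P Q is the divergence and not a
   default value. *)
definition KL_finite :: "'x measure \<Rightarrow> 'x measure \<Rightarrow> bool" where
  "KL_finite P Q \<longleftrightarrow>
     absolutely_continuous Q P \<and> integrable P (entropy_density (exp 1) Q P)"

definition midpoint_measure :: "'x measure \<Rightarrow> 'x measure \<Rightarrow> 'x measure" where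
  "midpoint_measure P Q =
     measure_of (space P) (sets P) (\<lambda>A. (emeasure P A + emeasure Q A) / 2)"

(* No finiteness condition is needed for JSD: both densities w.r.t. the midpoint are at most 2. *)
definition JSD :: "'x measure \<Rightarrow> 'x measure \<Rightarrow> real" where
  "JSD P Q = KL P (midpoint_measure P Q) / 2 + KL Q (midpoint_measure P Q) / 2"

(* Meaningful where f is differentiable, the vector v then being unique. *)
definition grad :: "('t::real_inner \<Rightarrow> real) \<Rightarrow> 't \<Rightarrow> 't" where
  "grad f t = (THE v. GDERIV f t :> v)"

(* The probability measure proportional to w(x) M(dx). *)
definition normalized_density :: "'x measure \<Rightarrow> ('x \<Rightarrow> real) \<Rightarrow> 'x measure" where
  "normalized_density M w =
     density M (\<lambda>x. ennreal (w x) / (\<integral>\<^sup>+u. ennreal (w u) \<partial>M))"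

definition p_label :: "nat pmf" where
  "p_label = pmf_of_set {0, 1}"

definition p_gen :: "'z measure \<Rightarrow> 'x measure \<Rightarrow> ('t \<Rightarrow> 'z \<Rightarrow> 'x) \<Rightarrow> 't \<Rightarrow> 'x measure" where
  "p_gen prior X G \<theta> = distr prior X (G \<theta>)"

(* Labels are 0 and 1; the value at other naturals is irrelevant, being p_label-null. *)
definition p_cond ::
  "'z measure \<Rightarrow> 'x measure \<Rightarrow> ('t \<Rightarrow> 'z \<Rightarrow> 'x) \<Rightarrow> 'x measure \<Rightarrow> 't \<Rightarrow> nat \<Rightarrow> 'x measure" where
  "p_cond prior X G p_data \<theta> y = (if y = 0 then p_gen prior X G \<theta> else p_data)"

definition p_marginal ::
  "'z measure \<Rightarrow> 'x measure \<Rightarrow> ('t \<Rightarrow> 'z \<Rightarrow> 'x) \<Rightarrow> 'x measure \<Rightarrow> 't \<Rightarrow> 'x measure" where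
  "p_marginal prior X G p_data \<theta> = measure_pmf p_label \<bind> p_cond prior X G p_data \<theta>"

definition q_disc :: "('f \<Rightarrow> 'x \<Rightarrow> real) \<Rightarrow> 'f \<Rightarrow> nat \<Rightarrow> 'x \<Rightarrow> real" where
  "q_disc D \<phi> y x = (if y = 1 then D \<phi> x else 1 - D \<phi> x)"

definition q_rev :: "('f \<Rightarrow> 'x \<Rightarrow> real) \<Rightarrow> 'f \<Rightarrow> nat \<Rightarrow> 'x \<Rightarrow> real" where
  "q_rev D \<phi> y x = q_disc D \<phi> (1 - y) x"

definition q_rev_cond ::
  "'z measure \<Rightarrow> 'x measure \<Rightarrow> ('t \<Rightarrow> 'z \<Rightarrow> 'x) \<Rightarrow> 'x measure \<Rightarrow> ('f \<Rightarrow> 'x \<Rightarrow> real) \<Rightarrow>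
    't \<Rightarrow> 'f \<Rightarrow> nat \<Rightarrow> 'x measure" where
  "q_rev_cond prior X G p_data D \<theta>0 \<phi>0 y =
     normalized_density (p_marginal prior X G p_data \<theta>0) (q_rev D \<phi>0 y)"

(* ln 0 = 0 plays no role where KL_finite (p_cond ... y) (q_rev_cond ... y) holds: absolute
   continuity makes q_rev positive almost surely, and integrability of ln q_rev follows too. *)
definition gen_objective ::
  "'z measure \<Rightarrow> 'x measure \<Rightarrow> ('t \<Rightarrow> 'z \<Rightarrow> 'x) \<Rightarrow> 'x measure \<Rightarrow> ('f \<Rightarrow> 'x \<Rightarrow> real) \<Rightarrow>
    'f \<Rightarrow> 't \<Rightarrow> real" where
  "gen_objective prior X G p_data D \<phi>0 \<theta> =
     - measure_pmf.expectation p_label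
         (\<lambda>y. \<integral>x. ln (q_rev D \<phi>0 y x) \<partial>p_cond prior X G p_data \<theta> y)"

definition div_objective ::
  "'z measure \<Rightarrow> 'x measure \<Rightarrow> ('t \<Rightarrow> 'z \<Rightarrow> 'x) \<Rightarrow> 'x measure \<Rightarrow> ('f \<Rightarrow> 'x \<Rightarrow> real) \<Rightarrow>
    't \<Rightarrow> 'f \<Rightarrow> 't \<Rightarrow> real" where
  "div_objective prior X G p_data D \<theta>0 \<phi>0 \<theta> =
     measure_pmf.expectation p_label
       (\<lambda>y. KL (p_cond prior X G p_data \<theta> y) (q_rev_cond prior X G p_data D \<theta>0 \<phi>0 y))
     - JSD (p_cond prior X G p_data \<theta> 0) (p_cond prior X G p_data \<theta> 1)"

end

theory Submission
  imports Defs
begin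

text \<open>
  Write \<open>M\<^sub>\<theta>\<close> for the mixture of \<open>p\<^sub>\<theta>(x|0)\<close> and \<open>p\<^sub>\<theta>(x|1)\<close>. Taking all densities with respect to
  \<open>M\<^sub>\<theta>\<^sub>0\<close>, the logarithms of \<open>p\<^sub>\<theta>(x|y)\<close> cancel between the two divergences, and the
  difference of the two objectives is a constant plus \<open>KL(M\<^sub>\<theta> \<parallel> M\<^sub>\<theta>\<^sub>0)\<close>. This is nonnegative and
  vanishes at \<open>\<theta>\<^sub>0\<close>, so the difference has a minimum there and its derivative is zero; in
  particular no differentiation under the integral sign is needed.
\<close>

section \<open>Divergences between measures with real densities over a common base\<close>

lemma AE_density_pos_of_abs_cont:
  fixes f g :: "'a \<Rightarrow> real"
  assumes [measurable]: "f \<in> borel_measurable N" "g \<in> borel_measurable N"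
    and ac: "absolutely_continuous (density N g) (density N f)"
  shows "AE x in density N f. 0 < f x \<and> 0 < g x"
proof -
  have "AE x in density N f. 0 < g x"
    by (rule absolutely_continuous_AE[OF _ ac]) (auto simp: AE_density)
  moreover have "AE x in density N f. 0 < f x"
    by (simp add: AE_density)
  ultimately show ?thesis by eventually_elim simp
qed

text \<open>Absolute continuity forces \<open>f\<close> to vanish almost everywhere where
  \<open>g\<close> does, so \<open>f / g\<close> is a density of the one measure with respect to the
  other; uniqueness of the Radon-Nikodym derivative identifies the two. Later proofs can then
  compute with explicit quotients.\<close>

lemma AE_entropy_density_density:
  fixes f g :: "'a \<Rightarrow> real"
  assumes N: "sigma_finite_measure N"
    and [measurable]: "f \<in> borel_measurable N" "g \<in> borel_measurable N"
    and nonneg: "\<And>x. x \<in> space N \<Longrightarrow> 0 \<le> f x" "\<And>x. x \<in> space N \<Longrightarrow> 0 \<le> g x"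
    and ac: "absolutely_continuous (density N g) (density N f)"
  shows "AE x in density N f. entropy_density (exp 1) (density N g) (density N f) x = ln (f x / g x)"
proof -
  interpret N: sigma_finite_measure N by fact
  \<comment> \<open>A real-valued density is nowhere infinite, so \<open>density N g\<close> is
    again sigma-finite, as uniqueness of the derivative requires.\<close>
  interpret G: sigma_finite_measure "density N g"
    by (subst N.sigma_finite_iff_density_finite) auto
  \<comment> \<open>On this set the conventions \<open>x / 0 = 0\<close> and \<open>ln 0 = 0\<close>
    never enter.\<close>
  have pos: "AE x in density N f. 0 < f x \<and> 0 < g x"
    by (rule AE_density_pos_of_abs_cont) (use assms in auto)
  have "AE x in N. 0 < f x \<longrightarrow> 0 < g x"
    using pos by (auto simp: AE_density)
  then have "AE x in N. g x = 0 \<longrightarrow> f x = 0"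
    using AE_space by eventually_elim (use nonneg in fastforce)
  then have "density (density N g) (\<lambda>x. f x / g x) = density N f"
    using nonneg by (intro density_density_divide) (auto intro!: AE_I2)
  then have "AE x in density N g. ennreal (f x / g x) = RN_deriv (density N g) (density N f) x"
    by (intro G.RN_deriv_unique) auto
  then have "AE x in density N f. ennreal (f x / g x) = RN_deriv (density N g) (density N f) x"
    by (rule absolutely_continuous_AE[OF _ ac, rotated]) simp
  with pos show ?thesis
  proof eventually_elim
    case (elim x)
    then have "enn2real (RN_deriv (density N g) (density N f) x) = f x / g x"
      by (metis divide_nonneg_nonneg enn2real_ennreal less_imp_le)
    then show ?case by (simp add: entropy_density_def log_def)
  qed
qed

lemma KL_density_density:
  fixes f g :: "'a \<Rightarrow> real"
  assumes "sigma_finite_measure N"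
    and [measurable]: "f \<in> borel_measurable N" "g \<in> borel_measurable N"
    and "\<And>x. x \<in> space N \<Longrightarrow> 0 \<le> f x" "\<And>x. x \<in> space N \<Longrightarrow> 0 \<le> g x"
    and "absolutely_continuous (density N g) (density N f)"
  shows "KL (density N f) (density N g) = (\<integral>x. ln (f x / g x) \<partial>density N f)"
  unfolding KL_def KL_divergence_def
  using AE_entropy_density_density[OF assms]
  by (intro integral_cong_AE) (auto intro: measurable_entropy_density)

lemma KL_finite_density_density_iff:
  fixes f g :: "'a \<Rightarrow> real"
  assumes "sigma_finite_measure N"
    and [measurable]: "f \<in> borel_measurable N" "g \<in> borel_measurable N"
    and "\<And>x. x \<in> space N \<Longrightarrow> 0 \<le> f x" "\<And>x. x \<in> space N \<Longrightarrow> 0 \<le> g x"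
    and "absolutely_continuous (density N g) (density N f)"
  shows "KL_finite (density N f) (density N g) \<longleftrightarrow> integrable (density N f) (\<lambda>x. ln (f x / g x))"
proof -
  have "integrable (density N f) (entropy_density (exp 1) (density N g) (density N f))
      \<longleftrightarrow> integrable (density N f) (\<lambda>x. ln (f x / g x))"
    using AE_entropy_density_density[OF assms] by (intro integrable_cong_AE) (auto intro: measurable_entropy_density)
  with assms show ?thesis by (simp add: KL_finite_def)
qed

text \<open>Since \<open>- t ln t \<le> 1 - t\<close>, only the positive part of \<open>ln f\<close> can fail to be integrable.\<close>

lemma integrable_neg_part_ln_density:
  fixes f :: "'a \<Rightarrow> real"
  assumes "finite_measure N" and [measurable]: "f \<in> borel_measurable N"
    and nonneg: "\<And>x. x \<in> space N \<Longrightarrow> 0 \<le> f x"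
  shows "integrable (density N f) (\<lambda>x. max 0 (- ln (f x)))"
proof -
  interpret finite_measure N by fact
  have bound: "f x * max 0 (- ln (f x)) \<le> 1" if "x \<in> space N" for x
  proof (cases "f x = 0")
    case False
    with nonneg[OF that] have pos: "0 < f x" by simp
    then have "f x * - ln (f x) \<le> f x * (1 / f x - 1)"
      using ln_le_minus_one[of "1 / f x"] by (intro mult_left_mono) (auto simp: ln_div)
    also have "\<dots> = 1 - f x"
      using pos by (simp add: right_diff_distrib)
    finally show ?thesis using pos by (auto simp: max_def)
  qed simp
  have "integrable N (\<lambda>x. f x * max 0 (- ln (f x)))"
    using bound nonneg by (intro integrable_const_bound[where B = 1] AE_I2) (auto simp: abs_mult)
  then show ?thesis
    using nonneg by (subst integrable_real_density) (auto intro!: AE_I2)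
qed

section \<open>The midpoint measure, and splitting divergences into integrals of logarithms\<close>

lemma space_midpoint_measure [simp]: "space (midpoint_measure P Q) = space P"
  by (simp add: midpoint_measure_def)

lemma sets_midpoint_measure [simp]: "sets (midpoint_measure P Q) = sets P"
  by (simp add: midpoint_measure_def)

lemma emeasure_midpoint_measure:
  assumes [simp]: "sets Q = sets P"
  shows "emeasure (midpoint_measure P Q) A = (emeasure P A + emeasure Q A) / 2"
proof (cases "A \<in> sets P")
  case True
  have "countably_additive (sets P) (\<lambda>A. (emeasure P A + emeasure Q A) / 2)"
    by (auto simp: countably_additive_def suminf_emeasure suminf_add[symmetric])
  with True show ?thesis
    by (intro emeasure_measure_of[OF midpoint_measure_def])
      (auto simp: positive_def sets.space_closed dest: sets.sets_into_space)
\<comment> \<open>Outside the common sigma-algebra all three measures take the default value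
  0.\<close>
qed (simp add: emeasure_notin_sets)

lemma midpoint_measure_density:
  fixes f g :: "'a \<Rightarrow> real"
  assumes [measurable]: "f \<in> borel_measurable N" "g \<in> borel_measurable N"
    and nonneg: "\<And>x. x \<in> space N \<Longrightarrow> 0 \<le> f x" "\<And>x. x \<in> space N \<Longrightarrow> 0 \<le> g x"
  shows "midpoint_measure (density N f) (density N g) = density N (\<lambda>x. (f x + g x) / 2)"
proof (rule measure_eqI)
  fix A assume "A \<in> sets (midpoint_measure (density N f) (density N g))"
  then have [measurable]: "A \<in> sets N" by simp
  have "emeasure (density N (\<lambda>x. (f x + g x) / 2)) A
      = (\<integral>\<^sup>+x. (ennreal (f x) * indicator A x + ennreal (g x) * indicator A x) / 2 \<partial>N)"
    using nonneg
    by (subst emeasure_density)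
      (auto intro!: nn_integral_cong simp: divide_ennreal[symmetric] split: split_indicator)
  then show "emeasure (midpoint_measure (density N f) (density N g)) A
      = emeasure (density N (\<lambda>x. (f x + g x) / 2)) A"
    by (simp add: emeasure_midpoint_measure emeasure_density nn_integral_divide nn_integral_add)
qed simp

text \<open>The quotient \<open>f / m\<close> is at most 2, so its logarithm is bounded above, while
  the negative part is integrable by \<open>integrable_neg_part_ln_density\<close>. Subtracting it
  from the integrable \<open>ln f\<close> leaves \<open>ln m\<close>, and the divergence from the
  midpoint splits into two finite integrals.\<close>

lemma integrable_ln_mean_density:
  fixes f g :: "'a \<Rightarrow> real"
  assumes N: "prob_space N"
    and [measurable]: "f \<in> borel_measurable N" "g \<in> borel_measurable N"
    and nonneg: "\<And>x. x \<in> space N \<Longrightarrow> 0 \<le> f x" "\<And>x. x \<in> space N \<Longrightarrow> 0 \<le> g x"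
    and prob: "prob_space (density N f)" "prob_space (density N g)"
    and int: "integrable (density N f) (\<lambda>x. ln (f x))"
  defines "m \<equiv> \<lambda>x. (f x + g x) / 2"
  shows "integrable (density N f) (\<lambda>x. ln (m x))" (is ?I)
    and "KL (density N f) (density N m)
      = (\<integral>x. ln (f x) \<partial>density N f) - (\<integral>x. ln (m x) \<partial>density N f)" (is ?K)
proof -
  interpret N: prob_space N by fact
  interpret P: prob_space "density N f" by fact
  interpret Q: prob_space "density N g" by fact
  have [measurable]: "m \<in> borel_measurable N" by (simp add: m_def)
  have m: "0 \<le> m x" if "x \<in> space N" for x using nonneg that by (simp add: m_def)
  have m0: "f x = 0" if "x \<in> space N" "m x = 0" for x
    using nonneg that by (auto simp: m_def add_nonneg_eq_0_iff)
  have M: "density N m = midpoint_measure (density N f) (density N g)"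
    unfolding m_def by (rule midpoint_measure_density[symmetric]) (use nonneg in auto)
  have finM: "finite_measure (density N m)"
    by (rule finite_measureI)
      (use P.emeasure_space_1 Q.emeasure_space_1 in \<open>simp add: M emeasure_midpoint_measure\<close>)
  \<comment> \<open>Change of base: relative to the midpoint, the first measure has density
    \<open>f / m\<close>. The midpoint is finite, so the bound on negative parts applies over
    it.\<close>
  have PM: "density (density N m) (\<lambda>x. f x / m x) = density N f"
    using m m0 nonneg by (intro density_density_divide) (auto intro!: AE_I2)
  have ac: "absolutely_continuous (density N m) (density N f)"
    unfolding PM[symmetric] by (rule absolutely_continuousI_density) simp
  have pos: "AE x in density N f. 0 < f x \<and> 0 < m x"
    by (rule AE_density_pos_of_abs_cont) (use nonneg m ac in auto)
  have neg: "integrable (density N f) (\<lambda>x. max 0 (- ln (f x / m x)))"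
    unfolding PM[symmetric]
    by (rule integrable_neg_part_ln_density) (use finM nonneg m in auto)
  have "integrable (density N f) (\<lambda>x. ln (f x / m x))"
  proof (rule Bochner_Integration.integrable_bound)
    show "integrable (density N f) (\<lambda>x. ln 2 + max 0 (- ln (f x / m x)))"
      using neg by simp
    show "AE x in density N f. norm (ln (f x / m x)) \<le> norm (ln 2 + max 0 (- ln (f x / m x)))"
      using pos AE_space
    proof eventually_elim
      case (elim x)
      then have "f x / m x \<le> 2" using nonneg(2)[of x] by (simp add: field_simps m_def)
      with elim have "ln (f x / m x) \<le> ln 2" by (subst ln_le_cancel_iff) auto
      then show ?case by (auto simp: max_def)
    qed
  qed simp
  from Bochner_Integration.integrable_diff[OF int this]
  have "integrable (density N f) (\<lambda>x. ln (f x) - ln (f x / m x))" .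
  moreover have eq: "AE x in density N f. ln (f x) - ln (f x / m x) = ln (m x)"
    using pos by eventually_elim (simp add: ln_div)
  ultimately show I: ?I
    by (subst integrable_cong_AE[OF _ _ eq, symmetric]) auto
  have "KL (density N f) (density N m) = (\<integral>x. ln (f x / m x) \<partial>density N f)"
    by (rule KL_density_density) (use N.sigma_finite_measure_axioms nonneg m ac in auto)
  also have "\<dots> = (\<integral>x. ln (f x) - ln (m x) \<partial>density N f)"
  proof (rule integral_cong_AE)
    show "AE x in density N f. ln (f x / m x) = ln (f x) - ln (m x)"
      using pos by eventually_elim (simp add: ln_div)
  qed simp_all
  finally show ?K using int I by simp
qed

text \<open>The normalized measure has density \<open>w / Z\<close> over \<open>N\<close>, so the
  logarithm splits as \<open>ln f - ln w + ln Z\<close>. Finiteness alone would only control the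
  sum. Here \<open>w \<le> 1\<close> gives \<open>- ln w \<ge> 0\<close>, and the negative part of
  \<open>ln f\<close> is integrable, so no cancellation of infinities can occur and each term is
  integrable separately.\<close>

lemma KL_normalized_density:
  fixes f w :: "'a \<Rightarrow> real"
  assumes N: "prob_space N"
    and [measurable]: "f \<in> borel_measurable N" "w \<in> borel_measurable N"
    and nonneg: "\<And>x. x \<in> space N \<Longrightarrow> 0 \<le> f x"
    and w: "\<And>x. x \<in> space N \<Longrightarrow> 0 \<le> w x" "\<And>x. x \<in> space N \<Longrightarrow> w x \<le> 1"
    and prob: "prob_space (density N f)"
    and fin: "KL_finite (density N f) (normalized_density N w)"
  shows "integrable (density N f) (\<lambda>x. ln (f x))" (is ?F)
    and "KL (density N f) (normalized_density N w)
      = (\<integral>x. ln (f x) \<partial>density N f) - (\<integral>x. ln (w x) \<partial>density N f) + ln (\<integral>x. w x \<partial>N)" (is ?K)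
proof -
  interpret N: prob_space N by fact
  interpret P: prob_space "density N f" by fact
  define Z where "Z = (\<integral>x. w x \<partial>N)"
  have intw: "integrable N w"
    using w by (intro N.integrable_const_bound[where B = 1] AE_I2) auto
  have Zw: "(\<integral>\<^sup>+x. ennreal (w x) \<partial>N) = ennreal Z"
    unfolding Z_def using w by (intro nn_integral_eq_integral intw) auto
  have "Z \<ge> 0" unfolding Z_def using w by (intro integral_nonneg_AE AE_I2)
  have ac: "absolutely_continuous (normalized_density N w) (density N f)"
    using fin by (simp add: KL_finite_def)
  \<comment> \<open>If \<open>Z = 0\<close>, then \<open>w\<close> vanishes almost everywhere and,
    as \<open>0 / 0 = 0\<close> in \<open>ennreal\<close>, the normalized measure is zero. Absolute
    continuity would make \<open>density N f\<close> zero too, although it has mass 1.\<close>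
  have "Z \<noteq> 0"
  proof
    assume "Z = 0"
    with Zw have "AE x in N. ennreal (w x) = 0"
      by (simp add: nn_integral_0_iff_AE)
    then have "emeasure (normalized_density N w) (space N) = 0"
      by (auto simp: normalized_density_def emeasure_density nn_integral_0_iff_AE elim!: eventually_mono)
    then have "space N \<in> null_sets (density N f)"
      using ac by (auto simp: absolutely_continuous_def normalized_density_def null_sets_def)
    with P.emeasure_space_1 show False by (simp add: null_sets_def)
  qed
  with \<open>Z \<ge> 0\<close> have Z: "Z > 0" by simp
  have nd: "normalized_density N w = density N (\<lambda>x. w x / Z)"
    unfolding normalized_density_def Zw using w Z
    by (intro density_cong AE_I2) (auto simp: divide_ennreal)
  have pos: "AE x in density N f. 0 < f x \<and> 0 < w x / Z"
    by (rule AE_density_pos_of_abs_cont) (use nonneg w Z ac in \<open>auto simp: nd\<close>)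
  have eq: "AE x in density N f. ln (f x / (w x / Z)) = ln (f x) - ln (w x) + ln Z"
    using pos by eventually_elim (use Z in \<open>simp add: ln_div ln_mult zero_less_divide_iff\<close>)
  have "integrable (density N f) (\<lambda>x. ln (f x / (w x / Z)))"
    using fin ac unfolding nd
    by (subst (asm) KL_finite_density_density_iff) (use N.sigma_finite_measure_axioms nonneg w Z in auto)
  then have "integrable (density N f) (\<lambda>x. ln (f x) - ln (w x) + ln Z)"
    by (subst (asm) integrable_cong_AE[OF _ _ eq]) auto
  from Bochner_Integration.integrable_diff[OF this P.integrable_const, of "ln Z"]
  have sum: "integrable (density N f) (\<lambda>x. ln (f x) - ln (w x))" by simp
  have neg: "integrable (density N f) (\<lambda>x. max 0 (- ln (f x)))"
    by (rule integrable_neg_part_ln_density) (use N.finite_measure_axioms nonneg in auto)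
  \<comment> \<open>The positive part of \<open>ln f\<close> is below
    \<open>\<bar>ln f - ln w\<bar>\<close> because \<open>ln w \<le> 0\<close>; the second summand
    of the bound covers the negative part.\<close>
  show F: ?F
  proof (rule Bochner_Integration.integrable_bound)
    show "integrable (density N f) (\<lambda>x. \<bar>ln (f x) - ln (w x)\<bar> + max 0 (- ln (f x)))"
      using sum neg by simp
    show "AE x in density N f. norm (ln (f x)) \<le> norm (\<bar>ln (f x) - ln (w x)\<bar> + max 0 (- ln (f x)))"
      using pos AE_space
    proof eventually_elim
      case (elim x)
      then have "ln (w x) \<le> 0" using w Z by (simp add: zero_less_divide_iff)
      then show ?case by (auto simp: max_def)
    qed
  qed simp
  from Bochner_Integration.integrable_diff[OF this sum]
  have W: "integrable (density N f) (\<lambda>x. ln (w x))" by simp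
  have "KL (density N f) (normalized_density N w) = (\<integral>x. ln (f x / (w x / Z)) \<partial>density N f)"
    unfolding nd by (rule KL_density_density) (use N.sigma_finite_measure_axioms nonneg w Z ac in \<open>auto simp: nd\<close>)
  also have "\<dots> = (\<integral>x. ln (f x) - ln (w x) + ln Z \<partial>density N f)"
    using eq by (intro integral_cong_AE) auto
  also have "\<dots> = (\<integral>x. ln (f x) \<partial>density N f) - (\<integral>x. ln (w x) \<partial>density N f) + ln Z"
    using F W P.prob_space by simp
  finally show ?K by (simp add: Z_def)
qed

section \<open>Decomposition of the averaged divergences minus the Jensen-Shannon term\<close>

lemma (in sigma_finite_measure) obtain_real_density:
  assumes "finite_measure P" "absolutely_continuous M P" "sets P = sets M"
  obtains f :: "'a \<Rightarrow> real"
  where "f \<in> borel_measurable M" "\<And>x. 0 \<le> f x" "P = density M f"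
proof -
  \<comment> \<open>Finiteness of \<open>P\<close> makes the derivative finite almost everywhere; a
    real version that is nonnegative everywhere meets the pointwise hypotheses of the lemmas
    above.\<close>
  obtain f where f: "f \<in> borel_measurable M" "AE x in M. RN_deriv M P x = ennreal (f x)" "\<And>x. 0 \<le> f x"
    using real_RN_deriv[OF assms] by metis
  have "P = density M (RN_deriv M P)"
    using assms by (simp add: density_RN_deriv)
  also have "\<dots> = density M f"
    using f by (intro density_cong) auto
  finally show thesis using that f by blast
qed

text \<open>With densities \<open>f\<close>, \<open>g\<close> and their mean \<open>m\<close>, the
  integrals of \<open>ln f\<close> and \<open>ln g\<close> drop out, leaving the average of the
  integrals of \<open>ln m\<close> under \<open>P\<close> and \<open>Q\<close>. That average is the
  integral of \<open>ln m\<close> under the midpoint, which is its divergence from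
  \<open>N\<close>.\<close>

lemma mean_KL_minus_JSD:
  fixes w0 w1 :: "'a \<Rightarrow> real"
  assumes N: "prob_space N" and P: "prob_space P" "sets P = sets N"
    and Q: "prob_space Q" "sets Q = sets N"
    and w0: "w0 \<in> borel_measurable N" "\<And>x. x \<in> space N \<Longrightarrow> 0 \<le> w0 x \<and> w0 x \<le> 1"
    and w1: "w1 \<in> borel_measurable N" "\<And>x. x \<in> space N \<Longrightarrow> 0 \<le> w1 x \<and> w1 x \<le> 1"
    and fin: "KL_finite P (normalized_density N w0)" "KL_finite Q (normalized_density N w1)"
  shows "(KL P (normalized_density N w0) + KL Q (normalized_density N w1)) / 2 - JSD P Q
      = - ((\<integral>x. ln (w0 x) \<partial>P) + (\<integral>x. ln (w1 x) \<partial>Q)) / 2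
        + (ln (\<integral>x. w0 x \<partial>N) + ln (\<integral>x. w1 x \<partial>N)) / 2 + KL (midpoint_measure P Q) N" (is ?E)
    and "0 \<le> KL (midpoint_measure P Q) N" (is ?NN)
proof -
  interpret N: prob_space N by fact
  interpret P: prob_space P by fact
  interpret Q: prob_space Q by fact
  have ac_nd: "absolutely_continuous N (normalized_density N w)"
    if "w \<in> borel_measurable N" for w :: "'a \<Rightarrow> real"
    unfolding normalized_density_def using that by (intro absolutely_continuousI_density) auto
  \<comment> \<open>Each normalized measure is itself a density over \<open>N\<close>, so absolute
    continuity passes on to \<open>N\<close> by transitivity.\<close>
  have ac: "absolutely_continuous N P" "absolutely_continuous N Q"
    using fin ac_nd[OF w0(1)] ac_nd[OF w1(1)] by (auto simp: KL_finite_def absolutely_continuous_def)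
  obtain f :: "'a \<Rightarrow> real" where f [measurable]: "f \<in> borel_measurable N" and f0: "\<And>x. 0 \<le> f x"
    and Pf: "P = density N f"
    using N.obtain_real_density[OF P.finite_measure_axioms ac(1) P(2)] by blast
  obtain g :: "'a \<Rightarrow> real" where g [measurable]: "g \<in> borel_measurable N" and g0: "\<And>x. 0 \<le> g x"
    and Qg: "Q = density N g"
    using N.obtain_real_density[OF Q.finite_measure_axioms ac(2) Q(2)] by blast
  define m where "m = (\<lambda>x. (f x + g x) / 2)"
  have [measurable]: "m \<in> borel_measurable N" by (simp add: m_def)
  have m0: "0 \<le> m x" for x using f0 g0 by (simp add: m_def)
  have M: "midpoint_measure P Q = density N m"
    unfolding m_def Pf Qg by (rule midpoint_measure_density) (use f0 g0 in auto)
  note KP = KL_normalized_density[OF N f w0(1) f0 _ _ P(1)[unfolded Pf] fin(1)[unfolded Pf]]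
  note KQ = KL_normalized_density[OF N g w1(1) g0 _ _ Q(1)[unfolded Qg] fin(2)[unfolded Qg]]
  have lnf: "integrable P (\<lambda>x. ln (f x))" unfolding Pf by (rule KP(1)) (use w0 in auto)
  have lng: "integrable Q (\<lambda>x. ln (g x))" unfolding Qg by (rule KQ(1)) (use w1 in auto)
  note JP = integrable_ln_mean_density[OF N f g f0 g0 P(1)[unfolded Pf] Q(1)[unfolded Qg]
      lnf[unfolded Pf]]
  \<comment> \<open>With the roles exchanged the mean appears as \<open>(g x + f x) / 2\<close>;
    \<open>add.commute\<close> reconciles it with \<open>m\<close> below.\<close>
  note JQ = integrable_ln_mean_density[OF N g f g0 f0 Q(1)[unfolded Qg] P(1)[unfolded Pf]
      lng[unfolded Qg]]
  have lnmP: "integrable N (\<lambda>x. f x * ln (m x))"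
    using JP(1) f0 by (subst (asm) integrable_real_density) (auto simp: m_def)
  have lnmQ: "integrable N (\<lambda>x. g x * ln (m x))"
    using JQ(1) g0 by (subst (asm) integrable_real_density) (auto simp: m_def add.commute)
  have mm: "m x * ln (m x) = (f x * ln (m x) + g x * ln (m x)) / 2" for x
    by (simp add: m_def field_simps)
  \<comment> \<open>Writing \<open>N\<close> as a density over itself lets
    \<open>KL_density_density\<close> compute the divergence from \<open>N\<close>.\<close>
  have N1: "density N (\<lambda>x. ennreal 1) = N" by (simp add: density_1)
  have "KL (density N m) (density N (\<lambda>x. ennreal 1)) = (\<integral>x. ln (m x / 1) \<partial>density N m)"
    by (rule KL_density_density)
      (use N.sigma_finite_measure_axioms m0 in \<open>auto simp: density_1 intro!: absolutely_continuousI_density\<close>)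
  then have "KL (midpoint_measure P Q) N = (\<integral>x. ln (m x) \<partial>density N m)"
    by (simp only: N1 M div_by_1)
  also have "\<dots> = (\<integral>x. m x * ln (m x) \<partial>N)"
    using m0 by (subst integral_real_density) auto
  also have "\<dots> = ((\<integral>x. f x * ln (m x) \<partial>N) + (\<integral>x. g x * ln (m x) \<partial>N)) / 2"
    unfolding mm using lnmP lnmQ by simp
  also have "\<dots> = ((\<integral>x. ln (m x) \<partial>P) + (\<integral>x. ln (m x) \<partial>Q)) / 2"
    unfolding Pf Qg using f0 g0 by (subst (1 2) integral_real_density) auto
  finally have KM: "KL (midpoint_measure P Q) N = ((\<integral>x. ln (m x) \<partial>P) + (\<integral>x. ln (m x) \<partial>Q)) / 2" .
  have "KL P (normalized_density N w0)
      = (\<integral>x. ln (f x) \<partial>P) - (\<integral>x. ln (w0 x) \<partial>P) + ln (\<integral>x. w0 x \<partial>N)"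
    unfolding Pf by (rule KP(2)) (use w0 in auto)
  moreover have "KL Q (normalized_density N w1)
      = (\<integral>x. ln (g x) \<partial>Q) - (\<integral>x. ln (w1 x) \<partial>Q) + ln (\<integral>x. w1 x \<partial>N)"
    unfolding Qg by (rule KQ(2)) (use w1 in auto)
  moreover have "KL P (midpoint_measure P Q) = (\<integral>x. ln (f x) \<partial>P) - (\<integral>x. ln (m x) \<partial>P)"
    unfolding M using JP(2) by (simp add: Pf m_def)
  moreover have "KL Q (midpoint_measure P Q) = (\<integral>x. ln (g x) \<partial>Q) - (\<integral>x. ln (m x) \<partial>Q)"
    unfolding M using JQ(2) by (simp add: Qg m_def add.commute)
  ultimately show ?E
    by (simp add: JSD_def KM field_simps)
  \<comment> \<open>Gibbs' inequality in base \<open>exp 1\<close>; it asks for total mass 1 of the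
    midpoint and integrability of \<open>m ln m\<close>, which follows from the two summands in
    \<open>mm\<close>.\<close>
  interpret I: information_space N "exp 1" by unfold_locales simp
  have "prob_space (density N m)"
    by (rule prob_spaceI)
      (use P.emeasure_space_1 Q.emeasure_space_1 sets_eq_imp_space_eq[OF P(2)] sets_eq_imp_space_eq[OF Q(2)]
       in \<open>simp flip: M add: emeasure_midpoint_measure P(2) Q(2)\<close>)
  moreover have "integrable N (\<lambda>x. m x * log (exp 1) (m x))"
    using lnmP lnmQ by (simp add: log_def mm)
  ultimately show ?NN
    unfolding M KL_def using m0 by (intro I.KL_nonneg) auto
qed

section \<open>Equal gradients from a minimum, and the adversarial setting\<close>

lemma grad_eq_of_min_diff:
  fixes f g :: "'t::real_inner \<Rightarrow> real"
  assumes "open S" "t \<in> S" "f differentiable (at t)" "g differentiable (at t)"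
    and min: "\<And>s. s \<in> S \<Longrightarrow> g t - f t \<le> g s - f s"
  shows "grad f t = grad g t"
proof -
  obtain f' g' where d: "(f has_derivative f') (at t)" "(g has_derivative g') (at t)"
    using assms by (auto simp: differentiable_def)
  \<comment> \<open>Fermat's rule: \<open>g - f\<close> is differentiable at \<open>t\<close> and
    minimal there over an open neighbourhood.\<close>
  have "(\<lambda>v. g' v - f' v) = (\<lambda>v. 0)"
    by (rule differential_zero_maxmin[OF \<open>t \<in> S\<close> \<open>open S\<close> has_derivative_diff[OF d(2,1)]])
      (use min in auto)
  then have "g' = f'" by (auto simp: fun_eq_iff)
  \<comment> \<open>\<open>grad\<close> is a definite description, so it suffices that the two
    predicates under \<open>THE\<close> agree.\<close>
  with d have "GDERIV f t :> v \<longleftrightarrow> GDERIV g t :> v" for v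
    unfolding gderiv_def by (metis has_derivative_unique)
  then show ?thesis by (simp add: grad_def)
qed

lemma expectation_p_label: "measure_pmf.expectation p_label h = (h 0 + h 1) / (2::real)"
  by (simp add: p_label_def integral_pmf_of_set)

text \<open>Links the base measure of \<open>q_rev_cond\<close>, built by \<open>bind\<close>, with
  the measure inside \<open>JSD\<close>. It is what makes the remaining divergence vanish at
  \<open>\<theta>0\<close>.\<close>

lemma p_marginal_eq_midpoint:
  assumes "prob_space prior" "prob_space p_data" "sets p_data = sets X" "G \<theta> \<in> measurable prior X"
  shows "p_marginal prior X G p_data \<theta>
    = midpoint_measure (p_cond prior X G p_data \<theta> 0) (p_cond prior X G p_data \<theta> 1)"
proof (rule measure_eqI)
  let ?K = "p_cond prior X G p_data \<theta>"
  have sets: "sets (?K y) = sets X" for y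
    using assms by (simp add: p_cond_def p_gen_def)
  have "prob_space (?K y)" for y
    using assms by (auto simp: p_cond_def p_gen_def intro: prob_space.prob_space_distr)
  \<comment> \<open>The label space is all of \<open>nat\<close>, so every value of the kernel must
    be a subprobability measure; labels other than 0 and 1 are sent to
    \<open>p_data\<close>.\<close>
  then have kernel: "?K \<in> measurable (measure_pmf p_label) (subprob_algebra X)"
    using sets by (auto simp: space_subprob_algebra intro: prob_space_imp_subprob_space)
  have [simp]: "sets (p_marginal prior X G p_data \<theta>) = sets X"
    unfolding p_marginal_def by (rule sets_bind) (auto simp: sets)
  then show "sets (p_marginal prior X G p_data \<theta>) = sets (midpoint_measure (?K 0) (?K 1))"
    by (simp add: sets)
  fix A assume "A \<in> sets (p_marginal prior X G p_data \<theta>)"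
  then have "A \<in> sets X" by simp
  have "emeasure (p_marginal prior X G p_data \<theta>) A = (\<integral>\<^sup>+y. emeasure (?K y) A \<partial>measure_pmf p_label)"
    unfolding p_marginal_def by (rule emeasure_bind) (use kernel \<open>A \<in> sets X\<close> in auto)
  also have "\<dots> = (emeasure (?K 0) A + emeasure (?K 1) A) / 2"
    unfolding p_label_def by (subst nn_integral_pmf_of_set) auto
  also have "\<dots> = emeasure (midpoint_measure (?K 0) (?K 1)) A"
    by (simp add: emeasure_midpoint_measure sets)
  finally show "emeasure (p_marginal prior X G p_data \<theta>) A = emeasure (midpoint_measure (?K 0) (?K 1)) A" .
qed

theorem lemma1:
  fixes X :: "'x measure" and prior :: "'z measure" and p_data :: "'x measure"
    and G :: "'t::euclidean_space \<Rightarrow> 'z \<Rightarrow> 'x"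
    and D :: "'f \<Rightarrow> 'x \<Rightarrow> real"
    and \<Theta> :: "'t set" and \<theta>0 :: 't and \<phi>0 :: 'f
  assumes prior: "prob_space prior"
    and data: "prob_space p_data" "sets p_data = sets X"
    and params: "open \<Theta>" "\<theta>0 \<in> \<Theta>"
    and G_meas: "\<And>\<theta>. \<theta> \<in> \<Theta> \<Longrightarrow> G \<theta> \<in> measurable prior X"
    and D_meas: "D \<phi>0 \<in> borel_measurable X"
    and D_range: "\<And>x. x \<in> space X \<Longrightarrow> 0 \<le> D \<phi>0 x \<and> D \<phi>0 x \<le> 1"
    and KL_fin: "\<And>\<theta> y. \<theta> \<in> \<Theta> \<Longrightarrow> y \<in> {0, 1} \<Longrightarrow>
        KL_finite (p_cond prior X G p_data \<theta> y) (q_rev_cond prior X G p_data D \<theta>0 \<phi>0 y)"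
    and diff_gen: "gen_objective prior X G p_data D \<phi>0 differentiable (at \<theta>0)"
    and diff_div: "div_objective prior X G p_data D \<theta>0 \<phi>0 differentiable (at \<theta>0)"
  shows "grad (gen_objective prior X G p_data D \<phi>0) \<theta>0
       = grad (div_objective prior X G p_data D \<theta>0 \<phi>0) \<theta>0"
proof (rule grad_eq_of_min_diff[OF params diff_gen diff_div])
  let ?K = "p_cond prior X G p_data"
  define N where "N = p_marginal prior X G p_data \<theta>0"
  define M where "M \<theta> = midpoint_measure (?K \<theta> 0) (?K \<theta> 1)" for \<theta>
  \<comment> \<open>The averaged logarithms of the two normalizing constants; they involve only
    \<open>\<theta>0\<close> and \<open>\<phi>0\<close>, hence are constant in
    \<open>\<theta>\<close>.\<close>
  define C where "C = (ln (\<integral>x. q_rev D \<phi>0 0 x \<partial>N) + ln (\<integral>x. q_rev D \<phi>0 1 x \<partial>N)) / 2"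
  have sets_K: "sets (?K \<theta> y) = sets X" for \<theta> y
    using data by (simp add: p_cond_def p_gen_def)
  have prob_K: "prob_space (?K \<theta> y)" if "\<theta> \<in> \<Theta>" for \<theta> y
    using prior data G_meas[OF that]
    by (auto simp: p_cond_def p_gen_def intro: prob_space.prob_space_distr)
  have NM: "N = M \<theta>0"
    unfolding N_def M_def by (rule p_marginal_eq_midpoint) (use prior data params G_meas in auto)
  have sets_N: "sets N = sets X" by (simp add: NM M_def sets_K)
  have space: "space (?K \<theta> y) = space X" "space N = space X" for \<theta> y
    using sets_K sets_N by (metis sets_eq_imp_space_eq)+
  have N: "prob_space N"
    by (rule prob_spaceI)
      (use prob_K[OF params(2), THEN prob_space.emeasure_space_1]
        in \<open>simp add: NM M_def emeasure_midpoint_measure sets_K space\<close>)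
  have q_meas: "q_rev D \<phi>0 y \<in> borel_measurable N" for y
    using D_meas unfolding q_rev_def q_disc_def measurable_cong_sets[OF sets_N refl] by simp
  \<comment> \<open>Truncated subtraction makes \<open>1 - y\<close> equal to 0 for every
    \<open>y \<ge> 1\<close>, so \<open>q_rev\<close> is always \<open>D \<phi>0\<close> or its
    complement.\<close>
  have q_range: "0 \<le> q_rev D \<phi>0 y x \<and> q_rev D \<phi>0 y x \<le> 1" if "x \<in> space N" for y x
    using D_range that by (simp add: q_rev_def q_disc_def space)
  have main: "div_objective prior X G p_data D \<theta>0 \<phi>0 \<theta> - gen_objective prior X G p_data D \<phi>0 \<theta>
      = C + KL (M \<theta>) N" "0 \<le> KL (M \<theta>) N" if "\<theta> \<in> \<Theta>" for \<theta>
  proof -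
    note dec = mean_KL_minus_JSD[OF N prob_K[OF that] _ prob_K[OF that] _ q_meas q_range q_meas q_range
        KL_fin[OF that, of 0, unfolded q_rev_cond_def, folded N_def]
        KL_fin[OF that, of 1, unfolded q_rev_cond_def, folded N_def], folded M_def]
    show "0 \<le> KL (M \<theta>) N" by (rule dec(2)) (simp_all add: sets_K sets_N)
    have "(KL (?K \<theta> 0) (normalized_density N (q_rev D \<phi>0 0))
          + KL (?K \<theta> 1) (normalized_density N (q_rev D \<phi>0 1))) / 2 - JSD (?K \<theta> 0) (?K \<theta> 1)
        = - ((\<integral>x. ln (q_rev D \<phi>0 0 x) \<partial>?K \<theta> 0) + (\<integral>x. ln (q_rev D \<phi>0 1 x) \<partial>?K \<theta> 1)) / 2
          + C + KL (M \<theta>) N"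
      unfolding C_def by (rule dec(1)) (simp_all add: sets_K sets_N)
    then show "div_objective prior X G p_data D \<theta>0 \<phi>0 \<theta> - gen_objective prior X G p_data D \<phi>0 \<theta>
        = C + KL (M \<theta>) N"
      by (simp add: div_objective_def gen_objective_def expectation_p_label q_rev_cond_def N_def field_simps)
  qed
  interpret N: prob_space N by (rule N)
  \<comment> \<open>At \<open>\<theta>0\<close> the mixture is the base measure itself, so the lower
    bound \<open>C\<close> from \<open>main\<close> is attained.\<close>
  have "KL (M \<theta>0) N = 0"
    by (simp add: NM[symmetric] KL_def N.KL_same_eq_0)
  with main params(2)
  show "div_objective prior X G p_data D \<theta>0 \<phi>0 \<theta>0 - gen_objective prior X G p_data D \<phi>0 \<theta>0
      \<le> div_objective prior X G p_data D \<theta>0 \<phi>0 \<theta> - gen_objective prior X G p_data D \<phi>0 \<theta>"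
    if "\<theta> \<in> \<Theta>" for \<theta>
    using that by simp
qed

end
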